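(* (RDR edge switching) Let $X$ be a $d$-RDR graph and let $f$ be a $d$-RDR coloring function on $X$. Suppose that $e_1=\{u_1,v_1\}$ and $e_2=\{u_2,v_2\}\in E(X)$ are two edges with endpoints of same color: $f(u_1)=f(u_2)\neq\emptyset$ (implying $f(v_1)=f(v_2)=\emptyset$). Construct the graph $X'$ with the same vertex set $V(X')=V(X)$ and edge set $E(X')=(E(X)\cup\{e_1',e_2'\})\setminus\{e_1,e_2\}$, where $e_1'=\{u_1,v_2\}$ and $e_2'=\{u_2,v_1\}$. Then $X'$ is a $d$-RDR graph with a $d$-RDR coloring function $f'=f$.
   Context: All graphs are finite and simple, and $d$ is a positive integer. For a graph $G=(V,E)$, $N(v)$ is the open neighbourhood of $v$. Let $\mathcal K=\{1,\dots,k\}$. A $k$-rainbow dominating function ($k$-RDF) on $G$ is a map $f\colon V\to 2^{\mathcal K}$ such that $f(v)=\emptyset$ implies $\bigcup_{u\in N(v)}f(u)=\mathcal K$, for all $v\in V$. Its weight is $w(f)=\sum_{v\in V}|f(v)|$, and the $k$-rainbow domination number $\gamma_{rk}(G)$ is the minimum weight of a $k$-RDF on $G$. It is known that a $d$-regular graph $G$ of order $n$ satisfies $\gamma_{rd}(G)\ge n/2$. A $d$-regular graph $G$ of order $n$ is called $d$-rainbow domination regular ($d$-RDR) if $\gamma_{rd}(G)=n/2$. A $d$-RDR coloring function on a $d$-RDR graph is a $d$-RDF of minimum weight $n/2$. It is known that for such a function the sets of colored vertices ($f(v)\ne\emptyset$) and non-colored vertices ($f(v)=\emptyset$) form a bipartition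 of the graph into sets of size $n/2$, and each colored vertex receives exactly one color.
   Formalization: The formal statement adds that u_1 and u_2 are distinct; if u_1 = u_2, then {e_1',e_2'} = {e_1,e_2}, so X' is X with these edges deleted and is not d-regular (e.g. the 4-cycle with d = 2). *)

theory Defs
  imports Complex_Main
begin

definition simple_graph :: "'a set \<Rightarrow> 'a set set \<Rightarrow> bool" where
  "simple_graph V E \<longleftrightarrow> finite V \<and> (\<forall>e\<in>E. e \<subseteq> V \<and> card e = 2)"

definition neighbourhood :: "'a set set \<Rightarrow> 'a \<Rightarrow> 'a set" where
  "neighbourhood E v = {u. {u, v} \<in> E}"

definition regular_graph :: "nat \<Rightarrow> 'a set \<Rightarrow> 'a set set \<Rightarrow> bool" where
  "regular_graph d V E \<longleftrightarrow> simple_graph V E \<and> (\<forall>v\<in>V. card (neighbourhood E v) = d)"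

(* A map V -> 2^{1..k} is a total function on the vertex type; its values outside V are irrelevant. *)
definition rainbow_dominating ::
    "nat \<Rightarrow> 'a set \<Rightarrow> 'a set set \<Rightarrow> ('a \<Rightarrow> nat set) \<Rightarrow> bool" where
  "rainbow_dominating k V E f \<longleftrightarrow>
     (\<forall>v\<in>V. f v \<subseteq> {1..k}) \<and>
     (\<forall>v\<in>V. f v = {} \<longrightarrow> (\<Union>u\<in>neighbourhood E v. f u) = {1..k})"

definition weight :: "'a set \<Rightarrow> ('a \<Rightarrow> nat set) \<Rightarrow> nat" where
  "weight V f = (\<Sum>v\<in>V. card (f v))"

(* The minimum exists: the constant function with value {1..k} is k-rainbow dominating. *)
definition rainbow_domination_number :: "nat \<Rightarrow> 'a set \<Rightarrow> 'a set set \<Rightarrow> nat" where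
  "rainbow_domination_number k V E =
     (LEAST w. \<exists>f. rainbow_dominating k V E f \<and> weight V f = w)"

definition RDR_graph :: "nat \<Rightarrow> 'a set \<Rightarrow> 'a set set \<Rightarrow> bool" where
  "RDR_graph d V E \<longleftrightarrow>
     regular_graph d V E \<and> real (rainbow_domination_number d V E) = real (card V) / 2"

(* Used for d-RDR graphs only, where the minimum weight is half the order. *)
definition RDR_coloring ::
    "nat \<Rightarrow> 'a set \<Rightarrow> 'a set set \<Rightarrow> ('a \<Rightarrow> nat set) \<Rightarrow> bool" where
  "RDR_coloring d V E f \<longleftrightarrow>
     rainbow_dominating d V E f \<and> weight V f = rainbow_domination_number d V E"

end

(* Let A be the set of coloured vertices and B the set of the others.  Count the sum of |f u| over
   all edges {u, v} with v in B: each v in B contributes at least d, and each u in A at most d |f u|,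
   so the weight w of f satisfies w >= |B|; trivially w >= |A|, hence 2 w >= n.  If 2 w = n, then
   all these inequalities are equalities: every coloured vertex has one colour and
   all its neighbours lie in B, and the d neighbours of a vertex of B have pairwise disjoint colour
   sets.  Therefore u1, u2, v1, v2 are distinct and the new edges are not in E, so switching
   exchanges one neighbour of each of the four vertices for another one; for v1 and v2
   the two have the same colour.  The new graph is thus d-regular, f still dominates it, and
   the lower bound n/2 shows that f has minimum weight. *)
theory Submission
  imports Defs
begin

section \<open>Neighbourhoods and double counting\<close>

lemma neighbourhood_commute: "u \<in> neighbourhood E v \<longleftrightarrow> v \<in> neighbourhood E u"
  by (simp add: neighbourhood_def insert_commute)

lemma neighbourhood_subset: "simple_graph V E \<Longrightarrow> neighbourhood E v \<subseteq> V"
  by (auto simp: simple_graph_def neighbourhood_def)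

lemma finite_neighbourhood: "simple_graph V E \<Longrightarrow> finite (neighbourhood E v)"
  using neighbourhood_subset finite_subset unfolding simple_graph_def by metis

text \<open>Double counting of the adjacent pairs \<open>(u, v)\<close> with \<open>v\<close> in
  \<open>B\<close>, each with weight \<open>g u\<close>: grouped by \<open>v\<close> on the left, by
  \<open>u\<close> on the right.\<close>

lemma sum_neighbourhood_swap:
  fixes g :: "'a \<Rightarrow> nat"
  assumes "simple_graph V E" and "B \<subseteq> V"
  shows "(\<Sum>v\<in>B. \<Sum>u\<in>neighbourhood E v. g u) = (\<Sum>u\<in>V. card (neighbourhood E u \<inter> B) * g u)"
proof -
  have fin: "finite V" "finite B"
    using assms finite_subset by (auto simp: simple_graph_def)
  have "(\<Sum>v\<in>B. \<Sum>u\<in>neighbourhood E v. g u) = (\<Sum>v\<in>B. \<Sum>u\<in>{u\<in>V. u \<in> neighbourhood E v}. g u)"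
    using neighbourhood_subset[OF assms(1)] by (intro sum.cong) auto
  also have "\<dots> = (\<Sum>u\<in>V. \<Sum>v\<in>{v\<in>B. u \<in> neighbourhood E v}. g u)"
    by (rule sum.swap_restrict[OF fin(2) fin(1)])
  also have "\<dots> = (\<Sum>u\<in>V. card (neighbourhood E u \<inter> B) * g u)"
  proof (rule sum.cong)
    fix u
    have "{v\<in>B. u \<in> neighbourhood E v} = neighbourhood E u \<inter> B"
      using neighbourhood_commute by fast
    then show "(\<Sum>v\<in>{v\<in>B. u \<in> neighbourhood E v}. g u) = card (neighbourhood E u \<inter> B) * g u"
      by simp
  qed simp
  finally show ?thesis .
qed

section \<open>The lower bound on the weight and its equality case\<close>

context
  fixes d :: nat and V :: "'a set" and E :: "'a set set" and f :: "'a \<Rightarrow> nat set"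
  assumes d_pos: "d > 0"
    and reg: "regular_graph d V E"
    and dom: "rainbow_dominating d V E f"
begin

lemma simple: "simple_graph V E"
  using reg by (simp add: regular_graph_def)

lemma fin_V: "finite V"
  using simple by (simp add: simple_graph_def)

lemma card_neighbourhood: "v \<in> V \<Longrightarrow> card (neighbourhood E v) = d"
  using reg by (simp add: regular_graph_def)

lemma finite_colours: "v \<in> V \<Longrightarrow> finite (f v)"
  using dom finite_subset[of "f v" "{1..d}"] by (simp add: rainbow_dominating_def)

lemma card_coloured_le_weight: "card {v\<in>V. f v \<noteq> {}} \<le> weight V f"
proof -
  have "card {v\<in>V. f v \<noteq> {}} = (\<Sum>v\<in>{v\<in>V. f v \<noteq> {}}. 1)"
    by simp
  also have "\<dots> \<le> (\<Sum>v\<in>{v\<in>V. f v \<noteq> {}}. card (f v))"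
    using finite_colours by (intro sum_mono) (simp add: Suc_le_eq card_gt_0_iff)
  also have "\<dots> \<le> weight V f"
    unfolding weight_def using fin_V by (intro sum_mono2) auto
  finally show ?thesis .
qed

text \<open>The neighbours of an uncoloured vertex cover all \<open>d\<close> colours. The right
  side is not yet bounded by \<open>d * weight V f\<close>, so that equality can later be read off
  vertex by vertex.\<close>

lemma uncoloured_count_le:
  "d * card {v\<in>V. f v = {}} \<le>
     (\<Sum>u\<in>V. card (neighbourhood E u \<inter> {v\<in>V. f v = {}}) * card (f u))"
proof -
  let ?B = "{v\<in>V. f v = {}}"
  have "d \<le> (\<Sum>u\<in>neighbourhood E v. card (f u))" if "v \<in> ?B" for v
  proof -
    have "card (\<Union>u\<in>neighbourhood E v. f u) = d"
      using that dom by (simp add: rainbow_dominating_def)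
    then show ?thesis
      using card_UN_le[OF finite_neighbourhood[OF simple, of v], of f] by simp
  qed
  then have "(\<Sum>v\<in>?B. d) \<le> (\<Sum>v\<in>?B. \<Sum>u\<in>neighbourhood E v. card (f u))"
    by (rule sum_mono)
  then show ?thesis
    using sum_neighbourhood_swap[OF simple, of ?B "\<lambda>u. card (f u)"] by (simp add: mult.commute)
qed

lemma card_neighbourhood_Int_le:
  "u \<in> V \<Longrightarrow> card (neighbourhood E u \<inter> B) \<le> d"
  using card_mono[OF finite_neighbourhood[OF simple], of "neighbourhood E u \<inter> B" u]
    card_neighbourhood by auto

lemma card_uncoloured_le_weight: "card {v\<in>V. f v = {}} \<le> weight V f"
proof -
  have "d * card {v\<in>V. f v = {}} \<le> (\<Sum>u\<in>V. d * card (f u))"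
    using uncoloured_count_le card_neighbourhood_Int_le
    by (meson order_trans sum_mono mult_le_mono1)
  then show ?thesis
    using d_pos by (simp add: weight_def flip: sum_distrib_left)
qed

lemma card_coloured_uncoloured: "card {v\<in>V. f v \<noteq> {}} + card {v\<in>V. f v = {}} = card V"
proof -
  have "card ({v\<in>V. f v \<noteq> {}} \<union> {v\<in>V. f v = {}}) = card {v\<in>V. f v \<noteq> {}} + card {v\<in>V. f v = {}}"
    using fin_V by (intro card_Un_disjoint) auto
  moreover have "{v\<in>V. f v \<noteq> {}} \<union> {v\<in>V. f v = {}} = V" by auto
  ultimately show ?thesis by simp
qed

lemma card_le_twice_weight: "card V \<le> 2 * weight V f"
  using card_coloured_le_weight card_uncoloured_le_weight card_coloured_uncoloured by linarith

text \<open>Equality forces exactly \<open>weight V f\<close> coloured vertices, so their nonempty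
  colour sets have average size 1.\<close>

lemma card_colour_le_one:
  assumes w: "2 * weight V f = card V" and "u \<in> V"
  shows "card (f u) \<le> 1"
proof (cases "f u = {}")
  case False
  let ?A = "{v\<in>V. f v \<noteq> {}}"
  have "(\<Sum>v\<in>?A. card (f v)) = weight V f"
    unfolding weight_def using fin_V by (intro sum.mono_neutral_left) auto
  also have "\<dots> = (\<Sum>v\<in>?A. 1)"
    using w card_coloured_le_weight card_uncoloured_le_weight card_coloured_uncoloured by simp
  finally have eq: "(\<Sum>v\<in>?A. 1) = (\<Sum>v\<in>?A. card (f v))" ..
  have "1 = card (f u)"
    by (rule sum_mono_inv[OF eq])
      (use False \<open>u \<in> V\<close> fin_V finite_colours in \<open>auto simp: Suc_le_eq card_gt_0_iff\<close>)
  then show ?thesis by simp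
qed simp

text \<open>Equality makes the termwise bound
  \<open>card (neighbourhood E u \<inter> ?B) \<le> d\<close> sharp wherever its factor
  \<open>card (f u)\<close> is positive.\<close>

lemma neighbours_of_coloured:
  assumes w: "2 * weight V f = card V" and u: "u \<in> V" "f u \<noteq> {}" and v: "v \<in> neighbourhood E u"
  shows "f v = {}"
proof -
  let ?B = "{v\<in>V. f v = {}}"
  have "(\<Sum>u\<in>V. d * card (f u)) = d * card ?B"
    using w card_coloured_le_weight card_uncoloured_le_weight card_coloured_uncoloured
    by (simp add: weight_def flip: sum_distrib_left)
  moreover have "(\<Sum>u\<in>V. card (neighbourhood E u \<inter> ?B) * card (f u)) \<le> (\<Sum>u\<in>V. d * card (f u))"
    by (intro sum_mono mult_le_mono1 card_neighbourhood_Int_le)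
  ultimately have eq: "(\<Sum>u\<in>V. card (neighbourhood E u \<inter> ?B) * card (f u)) = (\<Sum>u\<in>V. d * card (f u))"
    using uncoloured_count_le by linarith
  have "card (neighbourhood E u \<inter> ?B) * card (f u) = d * card (f u)"
    by (rule sum_mono_inv[OF eq])
      (use u fin_V card_neighbourhood_Int_le in \<open>auto intro!: mult_le_mono1\<close>)
  then have "card (neighbourhood E u \<inter> ?B) = card (neighbourhood E u)"
    using u finite_colours card_neighbourhood by simp
  then have "neighbourhood E u \<inter> ?B = neighbourhood E u"
    by (intro card_subset_eq finite_neighbourhood[OF simple]) auto
  then show ?thesis using v by blast
qed

text \<open>Otherwise \<open>y\<close> could be dropped, and \<open>d - 1\<close> vertices with at
  most one colour each would cover \<open>d\<close> colours.\<close>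

lemma neighbour_colours_differ:
  assumes w: "2 * weight V f = card V" and v: "v \<in> V" "f v = {}"
    and xy: "x \<in> neighbourhood E v" "y \<in> neighbourhood E v" "x \<noteq> y"
  shows "f x \<noteq> f y"
proof
  assume eq: "f x = f y"
  let ?N = "neighbourhood E v"
  have "(\<Union>u\<in>?N - {y}. f u) = (\<Union>u\<in>?N. f u)"
    using xy eq by blast
  also have "\<dots> = {1..d}"
    using dom v by (simp add: rainbow_dominating_def)
  finally have "card (\<Union>u\<in>?N - {y}. f u) = d"
    by simp
  moreover have "card (\<Union>u\<in>?N - {y}. f u) \<le> (\<Sum>u\<in>?N - {y}. card (f u))"
    by (intro card_UN_le finite_Diff finite_neighbourhood[OF simple])
  moreover have "\<dots> \<le> (\<Sum>u\<in>?N - {y}. 1)"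
    using card_colour_le_one[OF w] neighbourhood_subset[OF simple] by (intro sum_mono) blast
  moreover have "(\<Sum>u\<in>?N - {y}. 1) = d - 1"
    using card_neighbourhood[OF v(1)] xy by simp
  ultimately show False using d_pos by linarith
qed

end

text \<open>The lower bound applies to every competitor \<open>g\<close>, so attaining it certifies
  minimality.\<close>

lemma RDR_graph_if_half_weight:
  assumes "d > 0" and reg: "regular_graph d V E"
    and dom: "rainbow_dominating d V E f" and w: "2 * weight V f = card V"
  shows "RDR_graph d V E \<and> RDR_coloring d V E f"
proof -
  have "rainbow_domination_number d V E = weight V f"
    unfolding rainbow_domination_number_def
  proof (rule Least_equality)
    fix k assume "\<exists>g. rainbow_dominating d V E g \<and> weight V g = k"
    then have "card V \<le> 2 * k"
      using card_le_twice_weight[OF \<open>d > 0\<close> reg] by blast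
    then show "weight V f \<le> k"
      using w by simp
  qed (use dom in blast)
  then show ?thesis
    using reg dom w[symmetric] by (simp add: RDR_graph_def RDR_coloring_def)
qed

section \<open>Switching two edges\<close>

lemma card_exchange: "a \<in> A \<Longrightarrow> b \<notin> A \<Longrightarrow> finite A \<Longrightarrow> card (insert b (A - {a})) = card A"
  by (metis Diff_iff card.remove card_insert_disjoint finite_Diff)

text \<open>Distinctness puts each of the four vertices on exactly one removed and one added pair.
  \<open>E\<close> is arbitrary: an added pair may already be an edge, which matters only for
  degrees.\<close>

lemma neighbourhood_switch:
  assumes "distinct [u1, v1, u2, v2]"
    and "E' = (E \<union> {{u1, v2}, {u2, v1}}) - {{u1, v1}, {u2, v2}}"
  shows "neighbourhood E' x =
    (if x = u1 then insert v2 (neighbourhood E x - {v1})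
     else if x = u2 then insert v1 (neighbourhood E x - {v2})
     else if x = v1 then insert u2 (neighbourhood E x - {u1})
     else if x = v2 then insert u1 (neighbourhood E x - {u2})
     else neighbourhood E x)"
proof (rule set_eqI)
  fix y
  have "y \<in> neighbourhood E' x \<longleftrightarrow>
      (y \<in> neighbourhood E x \<or> {y, x} = {u1, v2} \<or> {y, x} = {u2, v1}) \<and>
      {y, x} \<noteq> {u1, v1} \<and> {y, x} \<noteq> {u2, v2}"
    unfolding assms(2) neighbourhood_def by blast
  then show "y \<in> neighbourhood E' x \<longleftrightarrow> y \<in>
    (if x = u1 then insert v2 (neighbourhood E x - {v1})
     else if x = u2 then insert v1 (neighbourhood E x - {v2})
     else if x = v1 then insert u2 (neighbourhood E x - {u1})
     else if x = v2 then insert u1 (neighbourhood E x - {u2})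
     else neighbourhood E x)"
    using assms(1) by (simp add: doubleton_eq_iff) blast
qed

theorem proposition2p4:
  fixes d :: nat and V :: "'a set" and E E' :: "'a set set"
    and f :: "'a \<Rightarrow> nat set" and u1 v1 u2 v2 :: 'a
  assumes "d > 0"
    and "RDR_graph d V E"
    and "RDR_coloring d V E f"
    and "{u1, v1} \<in> E" and "{u2, v2} \<in> E"
    and "u1 \<noteq> u2"
    and "f u1 = f u2" and "f u1 \<noteq> {}"
    and "E' = (E \<union> {{u1, v2}, {u2, v1}}) - {{u1, v1}, {u2, v2}}"
  shows "f v1 = {} \<and> f v2 = {} \<and> RDR_graph d V E' \<and> RDR_coloring d V E' f"
proof -
  have reg: "regular_graph d V E" and dom: "rainbow_dominating d V E f"
    using assms(2,3) by (auto simp: RDR_graph_def RDR_coloring_def)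
  have "real (weight V f) = real (card V) / 2"
    using assms(2,3) by (simp add: RDR_graph_def RDR_coloring_def)
  then have w: "2 * weight V f = card V" by linarith
  have simple_E: "simple_graph V E"
    using reg by (simp add: regular_graph_def)
  have inV: "u1 \<in> V" "v1 \<in> V" "u2 \<in> V" "v2 \<in> V"
    using simple_E assms(4,5) by (auto simp: simple_graph_def)
  have nbh: "v1 \<in> neighbourhood E u1" "u1 \<in> neighbourhood E v1"
    "v2 \<in> neighbourhood E u2" "u2 \<in> neighbourhood E v2"
    using assms(4,5) by (auto simp: neighbourhood_def insert_commute)
  have uncol: "f v1 = {}" "f v2 = {}"
    using neighbours_of_coloured[OF assms(1) reg dom w inV(1) _ nbh(1)]
      neighbours_of_coloured[OF assms(1) reg dom w inV(3) _ nbh(3)] assms(7,8) by simp_all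
  \<comment> \<open>Otherwise \<open>v1\<close> or \<open>v2\<close> would have both
    \<open>u1\<close> and \<open>u2\<close> as neighbours, with equal colour sets.\<close>
  have new: "u2 \<notin> neighbourhood E v1" "u1 \<notin> neighbourhood E v2"
    using neighbour_colours_differ[OF assms(1) reg dom w inV(2) uncol(1) nbh(2), of u2]
      neighbour_colours_differ[OF assms(1) reg dom w inV(4) uncol(2) _ nbh(4), of u1]
      assms(6,7) by blast+
  then have new': "v1 \<notin> neighbourhood E u2" "v2 \<notin> neighbourhood E u1"
    by (simp_all add: neighbourhood_def insert_commute)
  \<comment> \<open>Colouring separates the \<open>u\<close>s from the \<open>v\<close>s;
    \<open>v1\<close> and \<open>v2\<close> differ because only \<open>v1\<close> is adjacent to
    \<open>u1\<close>.\<close>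
  have dist: "distinct [u1, v1, u2, v2]"
    using uncol assms(6-8) new nbh(2) by auto
  note switch = neighbourhood_switch[OF dist assms(9)]
  have fin: "finite (neighbourhood E x)" for x
    using finite_neighbourhood[OF simple_E] .
  have "simple_graph V E'"
    using simple_E inV dist assms(9) by (auto simp: simple_graph_def)
  \<comment> \<open>Each exchange removes a present neighbour and inserts an absent one.\<close>
  moreover have "card (neighbourhood E' x) = card (neighbourhood E x)" for x
    unfolding switch using nbh new new' fin by (auto simp: card_exchange simp del: card_insert_disjoint)
  ultimately have reg': "regular_graph d V E'"
    using reg by (simp add: regular_graph_def)
  have exchange: "(\<Union>u\<in>insert b (A - {a}). f u) = (\<Union>u\<in>A. f u)" if "a \<in> A" "f b = f a" for a b A
    using that by blast
  \<comment> \<open>An uncoloured vertex is neither \<open>u1\<close> nor \<open>u2\<close>, and at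
    \<open>v1\<close> and \<open>v2\<close> the exchanged neighbours have equal colour sets.\<close>
  have "(\<Union>u\<in>neighbourhood E' v. f u) = (\<Union>u\<in>neighbourhood E v. f u)" if "f v = {}" for v
  proof -
    have "v \<noteq> u1" "v \<noteq> u2"
      using that assms(7,8) by auto
    then show ?thesis
      unfolding switch
      using exchange[OF nbh(2) assms(7)[symmetric]] exchange[OF nbh(4) assms(7)] by simp
  qed
  then have "rainbow_dominating d V E' f"
    using dom by (simp add: rainbow_dominating_def)
  then show ?thesis
    using RDR_graph_if_half_weight[OF assms(1) reg'] w uncol by blast
qed

end
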